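(* Consider $n$ agents with single-integrator kinematics $$\dot{x}_i=u_i,\quad i=1,\ldots,n,$$ where $x_i\in\mathbb{R}$ is the state and $u_i\in\mathbb{R}$ is the control input of the $i$th agent. Let the consensus algorithm be given by $$u_i=-\epsilon\sum_{j=1}^n a_{ij}(t)\,\mathrm{sig}(x_i-x_j)^{\alpha^\star},$$ where $\epsilon$ is any positive constant, $0<\alpha^\star<1$, and $a_{ij}(t)$ is the $(i,j)$th entry of the adjacency matrix $\mathcal{A}(t)$ of the switching interaction graph at time $t$ (as specified in the context). Assume that each interaction graph $\mathcal{G}_k$, $k=0,1,\ldots$, has a directed spanning tree. Then $x_i(t)-x_j(t)\to 0$ in finite time for all $i,j=1,\ldots,n$.
   Context: $\mathrm{sig}(x)^{\alpha}:=\mathrm{sgn}(x)|x|^{\alpha}$, where $\mathrm{sgn}$ is the signum function. Graphs: the agent set is $\mathcal{V}=\{1,\ldots,n\}$; in a directed graph with edge set $\mathcal{W}\subseteq\mathcal{V}^2$, an edge $(i,j)$ means that agent $j$ can obtain information from agent $i$ ($i$ is a neighbor of $j$). A directed path is a sequence of edges $(i_1,i_2),(i_2,i_3),\ldots$. The graph has a directed spanning tree if at least one agent has directed paths to all other agents. The adjacency matrix $\mathcal{A}=[a_{ij}]\in\mathbb{R}^{n\times n}$ has $a_{ij}>0$ if $(j,i)\in\mathcal{W}$, $a_{ij}=0$ otherwise, and $a_{ii}=0$. Switching: there are times $0=t_0<t_1<t_2<\cdots$ with $t_{k+1}-t_k\ge t_L$ for a positive constant $t_L$, such that $\mathcal{A}(t)$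 is constant, equal to $\mathcal{A}_k$, for $t\in[t_k,t_{k+1})$; $\mathcal{G}_k$ is the corresponding directed graph. Every nonzero (hence positive) entry of every $\mathcal{A}_k$ lies in $[\underline{a},\overline{a}]$, where $\underline{a},\overline{a}$ are positive constants. Solutions of the closed-loop system are in the Caratheodory sense (absolutely continuous functions satisfying the equations for almost all $t$). Convergence to $0$ "in finite time" means that there is a finite time from which on the quantity equals $0$. *)

theory Defs
  imports "HOL-Analysis.Analysis"
begin

definition sig :: "real \<Rightarrow> real \<Rightarrow> real"
  where "sig x \<alpha> = sgn x * \<bar>x\<bar> powr \<alpha>"

text \<open>
  Agents are the elements of a finite type. A directed graph is given by its edge relation
  \<open>W\<close>; an edge \<open>(i, j) \<in> W\<close> means that \<open>j\<close> receives information from \<open>i\<close>.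
\<close>

definition has_directed_spanning_tree :: "('n \<times> 'n) set \<Rightarrow> bool"
  where "has_directed_spanning_tree W \<longleftrightarrow> (\<exists>r. \<forall>j. j \<noteq> r \<longrightarrow> (r, j) \<in> W\<^sup>+)"

text \<open>
  Note the transposition: \<open>A $ i $ j\<close> belongs to the edge \<open>(j, i)\<close>. Diagonal entries are \<open>0\<close>
  irrespective of whether \<open>W\<close> contains self-loops.
\<close>

definition is_adjacency_matrix :: "('n::finite \<times> 'n) set \<Rightarrow> real ^ 'n ^ 'n \<Rightarrow> bool"
  where "is_adjacency_matrix W A \<longleftrightarrow>
    (\<forall>i. A $ i $ i = 0) \<and>
    (\<forall>i j. i \<noteq> j \<longrightarrow> (if (j, i) \<in> W then A $ i $ j > 0 else A $ i $ j = 0))"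

text \<open>
  The usual \<open>\<epsilon>\<close>-\<open>\<delta>\<close> notion of absolute continuity of a function; the library constant
  \<open>absolutely_continuous\<close> is about measures. A division \<open>D\<close> of some \<open>T \<subseteq> S\<close> is an arbitrary
  finite set of nonoverlapping compact intervals \<open>K = {Inf K..Sup K}\<close> contained in \<open>S\<close>.
\<close>

definition absolutely_continuous_fun_on :: "real set \<Rightarrow> (real \<Rightarrow> 'a::real_normed_vector) \<Rightarrow> bool"
  where "absolutely_continuous_fun_on S f \<longleftrightarrow>
    (\<forall>\<epsilon>>0. \<exists>\<delta>>0. \<forall>D T. D division_of T \<longrightarrow> T \<subseteq> S \<longrightarrow>
       (\<Sum>K\<in>D. Sup K - Inf K) < \<delta> \<longrightarrow> (\<Sum>K\<in>D. norm (f (Sup K) - f (Inf K))) < \<epsilon>)"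

text \<open>
  Caratheodory solutions of \<open>x' = F t x\<close> on \<open>[0, \<infinity>)\<close>. On this unbounded interval, absolute
  continuity is meant on every compact subinterval.
\<close>

definition caratheodory_solution ::
    "(real \<Rightarrow> 'a::real_normed_vector \<Rightarrow> 'a) \<Rightarrow> (real \<Rightarrow> 'a) \<Rightarrow> bool"
  where "caratheodory_solution F x \<longleftrightarrow>
    (\<forall>b\<ge>0. absolutely_continuous_fun_on {0..b} x) \<and>
    (AE t in lebesgue. t \<ge> 0 \<longrightarrow> (x has_vector_derivative F t (x t)) (at t within {0..}))"

definition consensus_input :: "real \<Rightarrow> real \<Rightarrow> real ^ 'n ^ 'n \<Rightarrow> real ^ 'n \<Rightarrow> real ^ 'n::finite"
  where "consensus_input \<epsilon> \<alpha> A x =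
    (\<chi> i. - \<epsilon> * (\<Sum>j\<in>UNIV. A $ i $ j * sig (x $ i - x $ j) \<alpha>))"

definition converges_to_zero_in_finite_time :: "(real \<Rightarrow> real) \<Rightarrow> bool"
  where "converges_to_zero_in_finite_time f \<longleftrightarrow> (\<exists>T\<ge>0. \<forall>t\<ge>T. f t = 0)"

end

(*
  The maximum of the states is nonincreasing and their minimum nondecreasing, so the spread V
  (maximum minus minimum) never grows. Let the graph be constant on [s, s + H V^(1 - alpha)], with
  V = V(s), and let r be a root of a spanning tree. After possibly replacing x by -x, x_r starts at
  distance at least V/2 below the maximum and, for small H, stays V/4 below it. Along an edge (j, i)
  a gap of size theta V at j forces a gap of size theta' V at i after a time of order V^(1 - alpha):
  the pull of j is of order V^alpha, which dominates the pull of all other agents as long as the gap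
  at i is small. Following the tree, all gaps become at least theta V, so the spread contracts by a
  factor q < 1 that is independent of s and of the graph.

  As V is bounded by V(0), one such contraction fits into every dwell interval if H is small, hence
  V decays geometrically along the switching times. Since 1 - alpha > 0, the times needed for
  infinitely many successive contractions form a convergent geometric series, whose sum is less than
  t_L once V is small. So V reaches 0 within a single dwell interval, without any switching.
*)

theory Submission
  imports Defs
begin

subsection \<open>Absolutely continuous functions\<close>

lemma absolutely_continuous_fun_onE:
  assumes "absolutely_continuous_fun_on S f" and "e > 0"
  obtains d where "d > 0" and "\<And>D T. D division_of T \<Longrightarrow> T \<subseteq> S \<Longrightarrow>
    (\<Sum>K\<in>D. Sup K - Inf K) < d \<Longrightarrow> (\<Sum>K\<in>D. norm (f (Sup K) - f (Inf K))) < e"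
  using assms unfolding absolutely_continuous_fun_on_def by meson

text \<open>
  An upper bound \<open>K\<close> on difference quotients over intervals straddling \<open>t\<close>. Unlike a bound on the
  derivative it makes sense for \<open>t \<mapsto> max\<^sub>i x\<^sub>i(t)\<close>, which need not be differentiable
  where the \<open>x\<^sub>i\<close> are.
\<close>

definition straddle_rate_le :: "real set \<Rightarrow> (real \<Rightarrow> real) \<Rightarrow> real \<Rightarrow> real \<Rightarrow> bool"
  where "straddle_rate_le S f K t \<longleftrightarrow>
    (\<forall>e>0. \<exists>d>0. \<forall>y\<in>S. \<forall>z\<in>S. y \<le> t \<longrightarrow> t \<le> z \<longrightarrow> t - y < d \<longrightarrow> z - t < d \<longrightarrow>
      f z - f y \<le> (K + e) * (z - y))"

text \<open>
  In a sufficiently fine tagged division, the intervals tagged in the exceptional null set have small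
  total length, so absolute continuity controls them; on the others the rate bound applies.
\<close>

lemma absolutely_continuous_increment_le:
  fixes f :: "real \<Rightarrow> real"
  assumes ab: "a \<le> b"
    and ac: "absolutely_continuous_fun_on {a..b} f"
    and ae: "AE t in lebesgue. t \<in> {a..b} \<longrightarrow> straddle_rate_le {a..b} f K t"
  shows "f b - f a \<le> K * (b - a)"
proof -
  define N where "N = {t. \<not> (t \<in> {a..b} \<longrightarrow> straddle_rate_le {a..b} f K t)}"
  have "N \<in> null_sets lebesgue"
    using ae unfolding N_def by (simp add: completion.AE_iff_null_sets)
  then have neg: "negligible N"
    by (simp add: negligible_iff_null_sets)
  \<comment> \<open>The three terms are the rate bound on the whole interval, the correction for the
    length of the badly tagged intervals, and the variation of \<open>f\<close> on them; all errors
    vanish as \<open>e\<close> tends to 0.\<close>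
  have approx: "f b - f a \<le> (K + e) * (b - a) + \<bar>K + e\<bar> * e + e" if e: "e > 0" for e
  proof -
    obtain \<delta> where \<delta>: "\<delta> > 0" and \<delta>D: "\<And>D T. D division_of T \<Longrightarrow> T \<subseteq> {a..b} \<Longrightarrow>
        (\<Sum>K\<in>D. Sup K - Inf K) < \<delta> \<Longrightarrow> (\<Sum>K\<in>D. norm (f (Sup K) - f (Inf K))) < e"
      using absolutely_continuous_fun_onE[OF ac e] by blast
    \<comment> \<open>Negligibility in gauge form: in a fine enough tagged division the intervals
      tagged in \<open>N\<close> have total length below \<open>min \<delta> e\<close>. The bound
      \<open>\<delta>\<close> triggers absolute continuity, the bound \<open>e\<close> controls the
      length correction.\<close>
    have "((indicator N :: real \<Rightarrow> real) has_integral 0) (cbox a b)"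
      using neg unfolding negligible_def by blast
    then obtain g1 where g1: "gauge g1" and g1D: "\<And>p. p tagged_division_of cbox a b \<Longrightarrow> g1 fine p \<Longrightarrow>
        norm ((\<Sum>(x,K)\<in>p. measure lborel K *\<^sub>R indicator N x) - (0::real)) < min \<delta> e"
      using \<delta> e unfolding has_integral by (elim allE[of _ "min \<delta> e"]) auto
    have "\<exists>d. \<forall>t. d t > 0 \<and> (t \<in> {a..b} - N \<longrightarrow> (\<forall>y\<in>{a..b}. \<forall>z\<in>{a..b}. y \<le> t \<longrightarrow> t \<le> z \<longrightarrow>
        t - y < d t \<longrightarrow> z - t < d t \<longrightarrow> f z - f y \<le> (K + e) * (z - y)))"
    proof (intro choice allI)
      fix t
      show "\<exists>d>0. t \<in> {a..b} - N \<longrightarrow> (\<forall>y\<in>{a..b}. \<forall>z\<in>{a..b}. y \<le> t \<longrightarrow> t \<le> z \<longrightarrow>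
        t - y < d \<longrightarrow> z - t < d \<longrightarrow> f z - f y \<le> (K + e) * (z - y))"
      proof (cases "t \<in> {a..b} - N")
        case True
        then have "straddle_rate_le {a..b} f K t"
          by (simp add: N_def)
        then show ?thesis
          using e unfolding straddle_rate_le_def by blast
      qed (use zero_less_one in blast)
    qed
    then obtain d where d: "\<And>t. d t > 0"
      and dD: "\<And>t y z. t \<in> {a..b} - N \<Longrightarrow> y \<in> {a..b} \<Longrightarrow> z \<in> {a..b} \<Longrightarrow> y \<le> t \<Longrightarrow> t \<le> z \<Longrightarrow>
        t - y < d t \<Longrightarrow> z - t < d t \<Longrightarrow> f z - f y \<le> (K + e) * (z - y)"
      by blast
    have "gauge (\<lambda>t. g1 t \<inter> ball t (d t))"
      using g1 d by (intro gauge_Int gauge_ball_dependent) auto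
    then obtain p where p: "p tagged_division_of {a..b}" and fine: "(\<lambda>t. g1 t \<inter> ball t (d t)) fine p"
      using fine_division_exists_real by blast
    have f1: "g1 fine p" and f2: "(\<lambda>t. ball t (d t)) fine p"
      using fine by (auto simp: fine_Int)
    note pD = tagged_division_ofD[OF p]
    define B where "B = {(t,I) \<in> p. t \<in> N}"
    have Bp: "B \<subseteq> p" and finB: "finite B"
      using pD(1) by (auto simp: B_def intro: finite_subset)
    have I: "\<exists>u v. I = {u..v} \<and> a \<le> u \<and> u \<le> t \<and> t \<le> v \<and> v \<le> b \<and> Sup I = v \<and> Inf I = u \<and> measure lborel I = v - u"
      if tI: "(t,I) \<in> p" for t I
    proof -
      obtain u v where uv: "I = cbox u v" using pD(4)[OF tI] by blast
      moreover have "t \<in> I" "I \<subseteq> {a..b}" using pD(2,3)[OF tI] by auto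
      ultimately show ?thesis by auto
    qed
    have len: "(\<Sum>(t,I)\<in>p. Sup I - Inf I) = b - a"
      using additive_tagged_division_1[OF ab p, of "\<lambda>x. x"] .
    have "(\<Sum>(t,I)\<in>p. measure lborel I *\<^sub>R indicator N t) = (\<Sum>(t,I)\<in>p. if (t,I) \<in> B then Sup I - Inf I else (0::real))"
      by (intro sum.cong refl) (use I in \<open>fastforce simp: B_def indicator_def\<close>)
    also have "\<dots> = (\<Sum>(t,I)\<in>B. Sup I - Inf I)"
      using sum.inter_restrict[OF pD(1), of "\<lambda>(t,I). Sup I - Inf I" B] Bp
      by (simp add: Int_absorb1 case_prod_unfold cong: if_cong)
    finally have lenB: "\<bar>\<Sum>(t,I)\<in>B. Sup I - Inf I\<bar> < min \<delta> e"
      using g1D[of p] p f1 by simp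
    \<comment> \<open>Absolute continuity speaks of sets of intervals, \<open>B\<close> of tagged
      ones. An interval with two tags has interior disjoint from itself, so it is a single point and
      contributes 0.\<close>
    have inj: "sum (\<lambda>(t,I). h I) B = sum h (snd ` B)" if "\<And>u. h {u..u} = 0" for h :: "real set \<Rightarrow> real"
    proof -
      have "sum h (snd ` B) = sum (h \<circ> snd) B"
      proof (rule sum.reindex_nontrivial[OF finB])
        fix P Q assume PQ: "P \<in> B" "Q \<in> B" "P \<noteq> Q" "snd P = snd Q"
        obtain t I where P: "P = (t,I)" by (cases P)
        obtain t' where Q: "Q = (t',I)" using PQ P by (cases Q) auto
        have PI: "(t,I) \<in> p" "(t',I) \<in> p" using PQ P Q Bp by auto
        then have "interior I \<inter> interior I = {}" using pD(5)[OF PI] PQ P Q by auto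
        moreover obtain u v where "I = {u..v}" "u \<le> v" using I[OF PI(1)] by fastforce
        ultimately have "I = {u..u}" by (auto simp: interior_atLeastAtMost_real)
        then show "h (snd P) = 0" using that P by simp
      qed
      then show ?thesis by (simp add: case_prod_unfold comp_def)
    qed
    have "B tagged_partial_division_of {a..b}"
      using p Bp by (meson tagged_division_of_def tagged_partial_division_subset)
    then have div: "(snd ` B) division_of \<Union>(snd ` B)"
      by (rule partial_division_of_tagged_division)
    have "(\<Sum>I\<in>snd ` B. norm (f (Sup I) - f (Inf I))) < e"
    proof (rule \<delta>D[OF div])
      show "\<Union> (snd ` B) \<subseteq> {a..b}" using Bp pD(3) by fastforce
      show "(\<Sum>I\<in>snd ` B. Sup I - Inf I) < \<delta>"
        using lenB inj[of "\<lambda>I. Sup I - Inf I"] by (simp add: abs_less_iff)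
    qed
    then have sB: "(\<Sum>(t,I)\<in>B. \<bar>f (Sup I) - f (Inf I)\<bar>) < e"
      using inj[of "\<lambda>I. \<bar>f (Sup I) - f (Inf I)\<bar>"] by simp
    have "f b - f a = (\<Sum>(t,I)\<in>p. f (Sup I) - f (Inf I))"
      using additive_tagged_division_1[OF ab p, of f] by simp
    also have "\<dots> = (\<Sum>(t,I)\<in>p - B. f (Sup I) - f (Inf I)) + (\<Sum>(t,I)\<in>B. f (Sup I) - f (Inf I))"
      by (rule sum.subset_diff[OF Bp pD(1)])
    also have "\<dots> \<le> (\<Sum>(t,I)\<in>p - B. (K + e) * (Sup I - Inf I)) + (\<Sum>(t,I)\<in>B. \<bar>f (Sup I) - f (Inf I)\<bar>)"
    proof (intro add_mono sum_mono)
      fix P assume "P \<in> p - B"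
      then obtain t I where P: "P = (t,I)" "(t,I) \<in> p" "t \<notin> N" by (auto simp: B_def)
      obtain u v where uv: "I = {u..v}" "a \<le> u" "u \<le> t" "t \<le> v" "v \<le> b" "Sup I = v" "Inf I = u"
        using I[OF P(2)] by blast
      have "I \<subseteq> ball t (d t)" using f2 P(2) by (auto simp: fine_def)
      moreover have "u \<in> I" "v \<in> I" using uv by auto
      ultimately have "u \<in> ball t (d t)" "v \<in> ball t (d t)" by blast+
      then have "t - u < d t" "v - t < d t" by (auto simp: dist_real_def)
      then show "(case P of (t,I) \<Rightarrow> f (Sup I) - f (Inf I)) \<le> (case P of (t,I) \<Rightarrow> (K + e) * (Sup I - Inf I))"
        using dD[of t u v] P uv by auto
    qed auto
    also have "(\<Sum>(t,I)\<in>p - B. (K + e) * (Sup I - Inf I)) = (K + e) * (\<Sum>(t,I)\<in>p - B. Sup I - Inf I)"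
      by (simp add: sum_distrib_left case_prod_unfold)
    also have "(\<Sum>(t,I)\<in>p - B. Sup I - Inf I) = (b - a) - (\<Sum>(t,I)\<in>B. Sup I - Inf I)"
      using sum.subset_diff[OF Bp pD(1), of "\<lambda>(t,I). Sup I - Inf I"] len by simp
    finally have "f b - f a \<le> (K + e) * (b - a) - (K + e) * (\<Sum>(t,I)\<in>B. Sup I - Inf I) + e"
      using sB by (simp add: right_diff_distrib)
    moreover have "- ((K + e) * (\<Sum>(t,I)\<in>B. Sup I - Inf I)) \<le> \<bar>K + e\<bar> * \<bar>\<Sum>(t,I)\<in>B. Sup I - Inf I\<bar>"
      unfolding abs_mult[symmetric] by (rule abs_ge_minus_self)
    moreover have "\<dots> \<le> \<bar>K + e\<bar> * e"
      using lenB by (intro mult_left_mono) auto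
    ultimately show ?thesis by linarith
  qed
  have "((\<lambda>e. (K + e) * (b - a) + \<bar>K + e\<bar> * e + e) \<longlongrightarrow> K * (b - a)) (at_right 0)"
    by (auto intro!: tendsto_eq_intros)
  then show ?thesis
    by (rule tendsto_lowerbound) (auto intro!: eventually_at_rightI[of 0 1] approx)
qed

text \<open>Transfers absolute continuity of the state to its components, its negation, its maximum
  and its restrictions, all of which have increments no larger than those of the state.\<close>

lemma absolutely_continuous_fun_on_dominated:
  assumes ac: "absolutely_continuous_fun_on S f" and "T \<subseteq> S"
    and le: "\<And>y z. y \<in> T \<Longrightarrow> z \<in> T \<Longrightarrow> norm (g y - g z) \<le> norm (f y - f z)"
  shows "absolutely_continuous_fun_on T g"
  unfolding absolutely_continuous_fun_on_def
proof (intro allI impI)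
  fix e :: real assume "e > 0"
  then obtain d where "d > 0" and d: "\<And>D R. D division_of R \<Longrightarrow> R \<subseteq> S \<Longrightarrow>
       (\<Sum>K\<in>D. Sup K - Inf K) < d \<Longrightarrow> (\<Sum>K\<in>D. norm (f (Sup K) - f (Inf K))) < e"
    using absolutely_continuous_fun_onE[OF ac] by blast
  show "\<exists>d>0. \<forall>D R. D division_of R \<longrightarrow> R \<subseteq> T \<longrightarrow>
       (\<Sum>K\<in>D. Sup K - Inf K) < d \<longrightarrow> (\<Sum>K\<in>D. norm (g (Sup K) - g (Inf K))) < e"
  proof (intro exI[of _ d] conjI allI impI)
    fix D R assume D: "D division_of R" "R \<subseteq> T" "(\<Sum>K\<in>D. Sup K - Inf K) < d"
    have "norm (g (Sup K) - g (Inf K)) \<le> norm (f (Sup K) - f (Inf K))" if K: "K \<in> D" for K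
    proof (rule le)
      obtain u v where uv: "K = cbox u v" using division_ofD(4)[OF D(1) K] by blast
      then have "u \<le> v" using division_ofD(3)[OF D(1) K] by auto
      then have "Sup K \<in> K" "Inf K \<in> K" using uv by auto
      then show "Sup K \<in> T" "Inf K \<in> T" using division_ofD(2)[OF D(1) K] D(2) by auto
    qed
    then have "(\<Sum>K\<in>D. norm (g (Sup K) - g (Inf K))) \<le> (\<Sum>K\<in>D. norm (f (Sup K) - f (Inf K)))"
      by (rule sum_mono)
    also have "\<dots> < e" using D(2) \<open>T \<subseteq> S\<close> by (intro d[OF D(1) _ D(3)]) simp
    finally show "(\<Sum>K\<in>D. norm (g (Sup K) - g (Inf K))) < e" .
  qed fact
qed

lemma absolutely_continuous_fun_on_imp_continuous_on:
  assumes ac: "absolutely_continuous_fun_on {a..b} f"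
  shows "continuous_on {a..b} f"
proof -
  have "\<exists>d>0. \<forall>y\<in>{a..b}. \<forall>z\<in>{a..b}. dist z y < d \<longrightarrow> dist (f z) (f y) < e" if "e > 0" for e
  proof -
    obtain d where "d > 0" and d: "\<And>D T. D division_of T \<Longrightarrow> T \<subseteq> {a..b} \<Longrightarrow>
       (\<Sum>K\<in>D. Sup K - Inf K) < d \<Longrightarrow> (\<Sum>K\<in>D. norm (f (Sup K) - f (Inf K))) < e"
      using absolutely_continuous_fun_onE[OF ac \<open>e > 0\<close>] by blast
    have le: "norm (f z - f y) < e" if "y \<in> {a..b}" "z \<in> {a..b}" "y \<le> z" "z - y < d" for y z
      using d[of "{{y..z}}" "{y..z}"] that division_of_self[of y z] by auto
    have "dist (f z) (f y) < e" if "y \<in> {a..b}" "z \<in> {a..b}" "dist z y < d" for y z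
      using le[of y z] le[of z y] that by (cases "y \<le> z") (auto simp: dist_norm norm_minus_commute)
    then show ?thesis using \<open>d > 0\<close> by blast
  qed
  then show ?thesis
    by (meson continuous_on_iff)
qed

section \<open>Rates obtained from derivatives, and descent below a level\<close>

lemma straddle_rate_le_subset:
  "straddle_rate_le S f K t \<Longrightarrow> T \<subseteq> S \<Longrightarrow> straddle_rate_le T f K t"
  unfolding straddle_rate_le_def by (meson subsetD)

lemma has_real_derivative_within_linear_bound:
  fixes f :: "real \<Rightarrow> real"
  assumes "(f has_real_derivative D) (at t within S)" and "e > 0"
  obtains d where "d > 0"
    and "\<And>w. w \<in> S \<Longrightarrow> \<bar>w - t\<bar> < d \<Longrightarrow> \<bar>f w - f t - D * (w - t)\<bar> \<le> e * \<bar>w - t\<bar>"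
proof -
  have "\<forall>e>0. \<exists>d>0. \<forall>w\<in>S. norm (w - t) < d \<longrightarrow> norm (f w - f t - D * (w - t)) \<le> e * norm (w - t)"
    using assms(1) unfolding has_field_derivative_def has_derivative_within_alt by (rule conjunct2)
  then show thesis
    using \<open>e > 0\<close> that unfolding real_norm_def by blast
qed

lemma has_real_derivative_imp_straddle_rate_le:
  assumes D: "(f has_real_derivative D) (at t within S)" and "t \<in> S" and "D \<le> K"
  shows "straddle_rate_le S f K t"
  unfolding straddle_rate_le_def
proof (intro allI impI)
  fix e :: real assume "e > 0"
  then obtain d where "d > 0" and
    d: "\<And>w. w \<in> S \<Longrightarrow> \<bar>w - t\<bar> < d \<Longrightarrow> \<bar>f w - f t - D * (w - t)\<bar> \<le> e * \<bar>w - t\<bar>"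
    using D has_real_derivative_within_linear_bound by blast
  have "f z - f y \<le> (K + e) * (z - y)"
    if "y \<in> S" "z \<in> S" "y \<le> t" "t \<le> z" "t - y < d" "z - t < d" for y z
  proof -
    have "f z - f t \<le> D * (z - t) + e * (z - t)" using d[of z] that by auto
    moreover have "f t - f y \<le> D * (t - y) + e * (t - y)"
      using d[of y] that by (auto simp: algebra_simps)
    moreover have "D * (z - y) \<le> K * (z - y)" using that \<open>D \<le> K\<close> by (intro mult_right_mono) auto
    ultimately show ?thesis by (simp add: algebra_simps)
  qed
  then show "\<exists>d>0. \<forall>y\<in>S. \<forall>z\<in>S. y \<le> t \<longrightarrow> t \<le> z \<longrightarrow> t - y < d \<longrightarrow> z - t < d \<longrightarrow>
      f z - f y \<le> (K + e) * (z - y)"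
    using \<open>d > 0\<close> by blast
qed

text \<open>A barrier argument: the descent at rate \<open>K\<close> is only required above the
  level \<open>U - l\<close>. If \<open>f\<close> never reaches the level, it descends all the time
  and loses at least \<open>l\<close>; otherwise it cannot climb back after its last visit
  \<open>u\<close>.\<close>

lemma absolutely_continuous_drift_below_level:
  fixes f :: "real \<Rightarrow> real"
  assumes ab: "a \<le> b"
    and ac: "absolutely_continuous_fun_on {a..b} f"
    and ae: "AE t in lebesgue. t \<in> {a..b} \<longrightarrow> f t > U - l \<longrightarrow> straddle_rate_le {a..b} f (- K) t"
    and U: "f a \<le> U" and K: "K \<ge> 0" and l: "l \<le> K * (b - a)"
  shows "f b \<le> U - l"
proof (rule ccontr)
  assume fb: "\<not> f b \<le> U - l"
  define Z where "Z = {t \<in> {a..b}. f t \<le> U - l}"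
  show False
  proof (cases "Z = {}")
    case True
    then have "AE t in lebesgue. t \<in> {a..b} \<longrightarrow> straddle_rate_le {a..b} f (- K) t"
      using ae
    proof eventually_elim
      case (elim t)
      then show ?case using True by (auto simp: Z_def)
    qed
    from absolutely_continuous_increment_le[OF ab ac this] show False
      using fb U l by simp
  next
    case False
    have "closed Z"
      unfolding Z_def
      using continuous_closed_preimage[OF absolutely_continuous_fun_on_imp_continuous_on[OF ac], of "{..U - l}"]
      by (simp add: vimage_def Int_def conj_commute)
    moreover have "bounded Z" by (rule bounded_subset[of "{a..b}"]) (auto simp: Z_def)
    ultimately obtain u where uZ: "u \<in> Z" and u: "\<And>t. t \<in> Z \<Longrightarrow> t \<le> u"
      using False compact_attains_sup[of Z] compact_eq_bounded_closed by blast
    have ub: "a \<le> u" "u \<le> b" "f u \<le> U - l" using uZ by (auto simp: Z_def)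
    \<comment> \<open>The rate is known only strictly above the level, hence not at \<open>u\<close>
      itself; one point is a null set.\<close>
    have "AE t in lebesgue. t \<noteq> u"
      by (intro AE_completion AE_lborel_singleton)
    with ae have "AE t in lebesgue. t \<in> {u..b} \<longrightarrow> straddle_rate_le {u..b} f (- K) t"
    proof eventually_elim
      case (elim t)
      show ?case
      proof
        assume t: "t \<in> {u..b}"
        then have "t \<notin> Z" using u[of t] elim(2) by auto
        then have "f t > U - l" using t ub by (auto simp: Z_def)
        then show "straddle_rate_le {u..b} f (- K) t"
          using elim(1) t ub straddle_rate_le_subset[of "{a..b}" f "- K" t "{u..b}"] by auto
      qed
    qed
    moreover have "absolutely_continuous_fun_on {u..b} f"
      using ub by (intro absolutely_continuous_fun_on_dominated[OF ac]) auto
    ultimately have "f b - f u \<le> - K * (b - u)"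
      using ub absolutely_continuous_increment_le by blast
    moreover have "K * (b - u) \<ge> 0" using K ub by simp
    ultimately show False using fb ub by auto
  qed
qed

subsection \<open>The largest component and the spread of a vector\<close>

definition upper :: "real ^ 'n::finite \<Rightarrow> real"
  where "upper z = Max (range (($) z))"

text \<open>The minimum enters as \<open>- upper (- z)\<close>, since \<open>- x\<close> is again a solution.\<close>

definition spread :: "real ^ 'n::finite \<Rightarrow> real"
  where "spread z = upper z + upper (- z)"

lemma component_le_upper: "z $ i \<le> upper z"
  unfolding upper_def by (intro Max_ge) auto

lemma upper_le: "(\<And>i. z $ i \<le> u) \<Longrightarrow> upper z \<le> u"
  unfolding upper_def by (subst Max_le_iff) auto

lemma upper_attained: obtains i where "upper z = z $ i"
  using Max_in[of "range (($) z)"] unfolding upper_def by fastforce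

lemma component_diff_le_spread: "z $ i - z $ j \<le> spread z"
  using component_le_upper[of z i] component_le_upper[of "- z" j] by (simp add: spread_def)

lemma spread_nonneg: "0 \<le> spread z"
  using component_diff_le_spread[of z undefined undefined] by simp

lemma norm_upper_diff_le: "norm (upper y - upper z) \<le> norm (y - z)"
proof -
  have "upper y \<le> upper z + norm (y - z)" for y z :: "real ^ 'n"
  proof (rule upper_le)
    fix i
    show "y $ i \<le> upper z + norm (y - z)"
      using component_le_norm_cart[of "y - z" i] component_le_upper[of z i] by simp
  qed
  from this[of y z] this[of z y] show ?thesis
    by (simp add: norm_minus_commute abs_le_iff)
qed

text \<open>Components below the maximum at \<open>t\<close> stay below it nearby by continuity, so
  only maximal ones matter. After \<open>t\<close> these rise at rate at most \<open>e\<close>;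
  before \<open>t\<close> a single maximal component suffices to bound the maximum from
  below.\<close>

lemma straddle_rate_le_upper:
  fixes x :: "real \<Rightarrow> real ^ 'n::finite"
  assumes t: "t \<in> S"
    and D: "\<And>i. ((\<lambda>t. x t $ i) has_real_derivative v i) (at t within S)"
    and v: "\<And>i. x t $ i = upper (x t) \<Longrightarrow> v i \<le> 0"
  shows "straddle_rate_le S (\<lambda>t. upper (x t)) 0 t"
  unfolding straddle_rate_le_def
proof (intro allI impI)
  fix e :: real assume e: "e > 0"
  have "\<exists>d>0. \<forall>w\<in>S. \<bar>w - t\<bar> < d \<longrightarrow> (t \<le> w \<longrightarrow> x w $ i \<le> upper (x t) + e * (w - t)) \<and>
      (w \<le> t \<longrightarrow> x t $ i = upper (x t) \<longrightarrow> upper (x t) \<le> x w $ i + e * (t - w))" for i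
  proof (cases "x t $ i = upper (x t)")
    case True
    obtain d where "d > 0" and d: "\<And>w. w \<in> S \<Longrightarrow> \<bar>w - t\<bar> < d \<Longrightarrow>
        \<bar>x w $ i - x t $ i - v i * (w - t)\<bar> \<le> e * \<bar>w - t\<bar>"
      using D[of i] e has_real_derivative_within_linear_bound by metis
    have "(t \<le> w \<longrightarrow> x w $ i \<le> upper (x t) + e * (w - t)) \<and>
      (w \<le> t \<longrightarrow> x t $ i = upper (x t) \<longrightarrow> upper (x t) \<le> x w $ i + e * (t - w))"
      if w: "w \<in> S" "\<bar>w - t\<bar> < d" for w
    proof (intro conjI impI)
      assume "t \<le> w"
      then have "v i * (w - t) \<le> 0" using v[OF True] by (simp add: mult_nonpos_nonneg)
      then show "x w $ i \<le> upper (x t) + e * (w - t)" using d[OF w] True \<open>t \<le> w\<close> by auto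
    next
      assume "w \<le> t"
      then have "v i * (w - t) \<ge> 0" using v[OF True] by (simp add: mult_nonpos_nonpos)
      then show "upper (x t) \<le> x w $ i + e * (t - w)" using d[OF w] True \<open>w \<le> t\<close> by auto
    qed
    then show ?thesis using \<open>d > 0\<close> by blast
  next
    case False
    then have "upper (x t) - x t $ i > 0" using component_le_upper[of "x t" i] by simp
    moreover have "continuous (at t within S) (\<lambda>t. x t $ i)"
      using D[of i] DERIV_continuous by blast
    ultimately obtain d where "d > 0" and
      d: "\<And>w. w \<in> S \<Longrightarrow> dist w t < d \<Longrightarrow> dist (x w $ i) (x t $ i) < upper (x t) - x t $ i"
      unfolding continuous_within_eps_delta by blast
    have "x w $ i \<le> upper (x t) + e * (w - t)" if "w \<in> S" "\<bar>w - t\<bar> < d" "t \<le> w" for w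
    proof -
      have "e * (w - t) \<ge> 0" using e that by simp
      then show ?thesis using d[of w] that by (simp add: dist_real_def)
    qed
    then show ?thesis using \<open>d > 0\<close> False by blast
  qed
  then obtain d where d: "\<And>i. d i > 0" and
    dt: "\<And>i w. w \<in> S \<Longrightarrow> \<bar>w - t\<bar> < d i \<Longrightarrow> t \<le> w \<Longrightarrow> x w $ i \<le> upper (x t) + e * (w - t)" and
    dw: "\<And>i w. w \<in> S \<Longrightarrow> \<bar>w - t\<bar> < d i \<Longrightarrow> w \<le> t \<Longrightarrow> x t $ i = upper (x t) \<Longrightarrow>
        upper (x t) \<le> x w $ i + e * (t - w)"
    by metis
  define d0 where "d0 = Min (range d)"
  have d0: "d0 > 0" "\<And>i. d0 \<le> d i" using d by (auto simp: d0_def)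
  obtain m where m: "upper (x t) = x t $ m" by (rule upper_attained)
  have "upper (x z) - upper (x y) \<le> (0 + e) * (z - y)"
    if "y \<in> S" "z \<in> S" "y \<le> t" "t \<le> z" "t - y < d0" "z - t < d0" for y z
  proof -
    have "upper (x z) \<le> upper (x t) + e * (z - t)"
      using that d0(2) by (intro upper_le dt) (auto intro: less_le_trans)
    moreover have "upper (x t) \<le> x y $ m + e * (t - y)"
      using that d0(2) m by (intro dw) (auto intro: less_le_trans)
    ultimately show ?thesis
      using component_le_upper[of "x y" m] by (simp add: algebra_simps)
  qed
  then show "\<exists>d>0. \<forall>y\<in>S. \<forall>z\<in>S. y \<le> t \<longrightarrow> t \<le> z \<longrightarrow> t - y < d \<longrightarrow> z - t < d \<longrightarrow>
      upper (x z) - upper (x y) \<le> (0 + e) * (z - y)"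
    using d0(1) by blast
qed

subsection \<open>The consensus flow\<close>

lemma sig_mono:
  assumes "0 < \<alpha>" and "y \<le> z"
  shows "sig y \<alpha> \<le> sig z \<alpha>"
proof -
  consider "0 \<le> y" | "y < 0" "0 \<le> z" | "z < 0" using assms by linarith
  then show ?thesis
  proof cases
    case 1
    then have "y powr \<alpha> \<le> z powr \<alpha>" using assms by (intro powr_mono2) auto
    then show ?thesis using 1 assms by (cases "y = 0") (auto simp: sig_def sgn_if)
  next
    case 2
    then have "sig y \<alpha> \<le> 0" "0 \<le> sig z \<alpha>" by (auto simp: sig_def sgn_if)
    then show ?thesis by simp
  next
    case 3
    then have "(- z) powr \<alpha> \<le> (- y) powr \<alpha>" using assms by (intro powr_mono2) auto
    then show ?thesis using 3 assms by (auto simp: sig_def sgn_if)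
  qed
qed

lemma sig_minus: "sig (- y) \<alpha> = - sig y \<alpha>"
  by (simp add: sig_def sgn_minus)

lemma sig_nonneg: "0 \<le> y \<Longrightarrow> sig y \<alpha> = y powr \<alpha>"
  by (cases "y = 0") (auto simp: sig_def)

lemma consensus_input_nth:
  "consensus_input \<epsilon> \<alpha> B z $ i = - \<epsilon> * (\<Sum>j\<in>UNIV. B $ i $ j * sig (z $ i - z $ j) \<alpha>)"
  by (simp add: consensus_input_def)

lemma consensus_input_minus: "consensus_input \<epsilon> \<alpha> B (- z) = - consensus_input \<epsilon> \<alpha> B z"
proof -
  have "sig ((- z) $ i - (- z) $ j) \<alpha> = - sig (z $ i - z $ j) \<alpha>" for i j
    using sig_minus[of "z $ i - z $ j" \<alpha>] by simp
  then have "consensus_input \<epsilon> \<alpha> B (- z) $ i = - consensus_input \<epsilon> \<alpha> B z $ i" for i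
    unfolding consensus_input_nth by (simp only: mult_minus_right sum_negf)
  then show ?thesis
    by (simp add: vec_eq_iff)
qed

text \<open>The strongest upward pull on \<open>i\<close> occurs when \<open>j\<close> sits at the
  upper bound \<open>U\<close> and the weight equals \<open>h\<close>.\<close>

lemma consensus_input_term_ge:
  assumes "0 < \<alpha>" and "0 \<le> b" "b \<le> h" and "z $ j \<le> U" "z $ i \<le> U"
  shows "- (h * (U - z $ i) powr \<alpha>) \<le> b * sig (z $ i - z $ j) \<alpha>"
proof -
  have "- sig (U - z $ i) \<alpha> \<le> sig (z $ i - z $ j) \<alpha>"
    using sig_mono[of \<alpha> "- (U - z $ i)" "z $ i - z $ j"] assms by (simp only: sig_minus)
  then have "- ((U - z $ i) powr \<alpha>) \<le> sig (z $ i - z $ j) \<alpha>"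
    using assms by (simp add: sig_nonneg)
  then have "b * - ((U - z $ i) powr \<alpha>) \<le> b * sig (z $ i - z $ j) \<alpha>"
    using assms by (intro mult_left_mono)
  moreover have "b * (U - z $ i) powr \<alpha> \<le> h * (U - z $ i) powr \<alpha>"
    using assms by (intro mult_right_mono) auto
  ultimately show ?thesis by simp
qed

text \<open>Only bounds on the weights are fixed here, and the negated solution shares them; the
  graphs enter later through \<open>edges_active\<close>.\<close>

locale consensus_flow =
  fixes \<epsilon> \<alpha> h :: real and A :: "real \<Rightarrow> real ^ 'n ^ 'n::finite" and x :: "real \<Rightarrow> real ^ 'n"
  assumes eps_pos: "0 < \<epsilon>" and alpha_pos: "0 < \<alpha>"
    and A_nonneg: "\<And>t i j. 0 \<le> t \<Longrightarrow> 0 \<le> A t $ i $ j"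
    and A_le: "\<And>t i j. 0 \<le> t \<Longrightarrow> A t $ i $ j \<le> h"
    and solution: "caratheodory_solution (\<lambda>t y. consensus_input \<epsilon> \<alpha> (A t) y) x"
begin

text \<open>Summing the worst case over all agents, an agent at distance g below an upper bound of
  the states rises at speed at most \<open>gain\<close> times g^\<alpha>.\<close>

definition gain :: real
  where "gain = \<epsilon> * (of_nat CARD('n) * h)"

lemma h_nonneg: "0 \<le> h"
  using A_nonneg[of 0 undefined undefined] A_le[of 0 undefined undefined] by linarith

lemma gain_nonneg: "0 \<le> gain"
  unfolding gain_def using eps_pos h_nonneg by simp

lemma absolutely_continuous_solution: "0 \<le> b \<Longrightarrow> absolutely_continuous_fun_on {0..b} x"
  using solution unfolding caratheodory_solution_def by (elim conjE allE impE)

lemma solution_derivative: "AE t in lebesgue. t \<ge> 0 \<longrightarrow>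
    (x has_vector_derivative consensus_input \<epsilon> \<alpha> (A t) (x t)) (at t within {0..})"
  using solution unfolding caratheodory_solution_def by (rule conjunct2)

text \<open>\<open>sig\<close> is odd, so negation preserves the equation; each result on the
  maximum then yields one on the minimum.\<close>

lemma reflected: "consensus_flow \<epsilon> \<alpha> h A (\<lambda>t. - x t)"
proof (rule consensus_flow.intro[OF eps_pos alpha_pos A_nonneg A_le])
  show "caratheodory_solution (\<lambda>t. consensus_input \<epsilon> \<alpha> (A t)) (\<lambda>t. - x t)"
    unfolding caratheodory_solution_def
  proof (intro conjI allI impI)
    fix b :: real assume "0 \<le> b"
    show "absolutely_continuous_fun_on {0..b} (\<lambda>t. - x t)"
    proof (rule absolutely_continuous_fun_on_dominated[OF absolutely_continuous_solution[OF \<open>0 \<le> b\<close>] order_refl])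
      show "norm (- x y - - x z) \<le> norm (x y - x z)" for y z
        by (simp add: norm_minus_commute)
    qed
  next
    show "AE t in lebesgue. t \<ge> 0 \<longrightarrow>
        ((\<lambda>t. - x t) has_vector_derivative consensus_input \<epsilon> \<alpha> (A t) (- x t)) (at t within {0..})"
      using solution_derivative
      by eventually_elim (simp add: consensus_input_minus has_vector_derivative_minus)
  qed
qed

section \<open>Regularity and rates of the components of a solution\<close>

lemma absolutely_continuous_state:
  assumes "0 \<le> a"
  shows "absolutely_continuous_fun_on {a..b} x"
proof (rule absolutely_continuous_fun_on_dominated)
  show "absolutely_continuous_fun_on {0..max 0 b} x"
    by (rule absolutely_continuous_solution) simp
qed (use assms in auto)

lemma absolutely_continuous_component:
  assumes "0 \<le> a"
  shows "absolutely_continuous_fun_on {a..b} (\<lambda>t. x t $ i)"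
proof (rule absolutely_continuous_fun_on_dominated[OF absolutely_continuous_state[OF assms] order_refl])
  show "norm (x y $ i - x z $ i) \<le> norm (x y - x z)" for y z
    using component_le_norm_cart[of "x y - x z" i] by simp
qed

lemma component_derivative:
  assumes "0 \<le> a"
  shows "AE t in lebesgue. t \<in> {a..b} \<longrightarrow> (\<forall>i. ((\<lambda>t. x t $ i) has_real_derivative
      consensus_input \<epsilon> \<alpha> (A t) (x t) $ i) (at t within {a..b}))"
proof -
  show ?thesis
    using solution_derivative
  proof eventually_elim
    case (elim t)
    show ?case
    proof (intro impI allI)
      fix i assume "t \<in> {a..b}"
      with elim assms have "(x has_vector_derivative consensus_input \<epsilon> \<alpha> (A t) (x t)) (at t within {a..b})"
        by (auto intro: has_vector_derivative_within_subset)
      from bounded_linear.has_vector_derivative[OF bounded_linear_vec_nth this]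
      show "((\<lambda>t. x t $ i) has_real_derivative consensus_input \<epsilon> \<alpha> (A t) (x t) $ i) (at t within {a..b})"
        by (simp add: has_real_derivative_iff_has_vector_derivative)
    qed
  qed
qed

lemma component_straddle_rate_le:
  assumes "0 \<le> a"
    and "\<And>t. t \<in> {a..b} \<Longrightarrow> P t \<Longrightarrow> consensus_input \<epsilon> \<alpha> (A t) (x t) $ i \<le> K"
  shows "AE t in lebesgue. t \<in> {a..b} \<longrightarrow> P t \<longrightarrow> straddle_rate_le {a..b} (\<lambda>t. x t $ i) K t"
  using component_derivative[OF assms(1), of b]
proof eventually_elim
  case (elim t)
  then show ?case
    using assms(2) has_real_derivative_imp_straddle_rate_le by blast
qed

text \<open>An agent at the maximum has no agent above it, so every term of its input pulls it down
  or vanishes.\<close>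

lemma upper_antimono:
  assumes "0 \<le> s" "s \<le> t"
  shows "upper (x t) \<le> upper (x s)"
proof -
  have "AE u in lebesgue. u \<in> {s..t} \<longrightarrow> straddle_rate_le {s..t} (\<lambda>t. upper (x t)) 0 u"
    using component_derivative[OF assms(1), of t]
  proof eventually_elim
    case (elim u)
    show ?case
    proof
      assume u: "u \<in> {s..t}"
      show "straddle_rate_le {s..t} (\<lambda>t. upper (x t)) 0 u"
      proof (rule straddle_rate_le_upper[OF u])
        show "((\<lambda>t. x t $ i) has_real_derivative consensus_input \<epsilon> \<alpha> (A u) (x u) $ i) (at u within {s..t})" for i
          using elim u by blast
        fix i assume i: "x u $ i = upper (x u)"
        have "0 \<le> (\<Sum>j\<in>UNIV. A u $ i $ j * sig (x u $ i - x u $ j) \<alpha>)"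
          using i component_le_upper[of "x u"] A_nonneg u assms
          by (intro sum_nonneg mult_nonneg_nonneg) (auto simp: sig_nonneg)
        then show "consensus_input \<epsilon> \<alpha> (A u) (x u) $ i \<le> 0"
          using eps_pos by (simp add: consensus_input_nth)
      qed
    qed
  qed
  moreover have "absolutely_continuous_fun_on {s..t} (\<lambda>t. upper (x t))"
    using absolutely_continuous_state[OF assms(1)] order_refl norm_upper_diff_le
    by (rule absolutely_continuous_fun_on_dominated)
  ultimately show ?thesis
    using absolutely_continuous_increment_le[OF assms(2)] by fastforce
qed

lemma lower_mono:
  assumes "0 \<le> s" "s \<le> t"
  shows "upper (- x t) \<le> upper (- x s)"
  using consensus_flow.upper_antimono[OF reflected assms] .

lemma spread_antimono: "0 \<le> s \<Longrightarrow> s \<le> t \<Longrightarrow> spread (x t) \<le> spread (x s)"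
  unfolding spread_def by (intro add_mono upper_antimono lower_mono)

lemma component_le_upper_earlier: "0 \<le> s \<Longrightarrow> s \<le> t \<Longrightarrow> x t $ i \<le> upper (x s)"
  using upper_antimono component_le_upper order_trans by blast

lemma upper_minus_component_le:
  assumes "0 \<le> s" "s \<le> t"
  shows "upper (x s) - x t $ i \<le> spread (x s)"
  using lower_mono[OF assms] component_le_upper[of "- x t" i] by (simp add: spread_def)

lemma input_le:
  assumes "0 \<le> t" and "\<And>j. x t $ j \<le> U"
  shows "consensus_input \<epsilon> \<alpha> (A t) (x t) $ i \<le> gain * (U - x t $ i) powr \<alpha>"
proof -
  have "(\<Sum>j\<in>(UNIV::'n set). - (h * (U - x t $ i) powr \<alpha>)) \<le> (\<Sum>j\<in>UNIV. A t $ i $ j * sig (x t $ i - x t $ j) \<alpha>)"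
    by (intro sum_mono consensus_input_term_ge alpha_pos A_nonneg A_le assms)
  then have "- (of_nat CARD('n) * (h * (U - x t $ i) powr \<alpha>)) \<le> (\<Sum>j\<in>UNIV. A t $ i $ j * sig (x t $ i - x t $ j) \<alpha>)"
    by simp
  from mult_left_mono[OF this, of \<epsilon>] eps_pos show ?thesis
    by (simp add: consensus_input_nth gain_def mult.assoc)
qed

text \<open>The agents \<open>i\<close> and \<open>j\<close> are at least \<open>l / 2\<close>
  apart, so the edge contributes a definite downward pull. All other terms are estimated by the
  worst case.\<close>

lemma input_le_edge:
  assumes "0 \<le> t" and U: "\<And>j. x t $ j \<le> U" and "0 \<le> lo" "lo \<le> A t $ i $ j"
    and xj: "x t $ j \<le> U - l" and xi: "U - l / 2 \<le> x t $ i" and "0 \<le> l"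
  shows "consensus_input \<epsilon> \<alpha> (A t) (x t) $ i \<le> gain * (U - x t $ i) powr \<alpha> - \<epsilon> * lo * (l / 2) powr \<alpha>"
proof -
  define p where "p = (U - x t $ i) powr \<alpha>"
  have p: "0 \<le> h * p" using h_nonneg by (simp add: p_def)
  have "sig (l / 2) \<alpha> \<le> sig (x t $ i - x t $ j) \<alpha>"
    using alpha_pos xj xi by (intro sig_mono) auto
  then have "lo * (l / 2) powr \<alpha> \<le> A t $ i $ j * sig (x t $ i - x t $ j) \<alpha>"
    using assms by (intro mult_mono) (auto simp: sig_nonneg A_nonneg)
  moreover have "(\<Sum>k\<in>UNIV - {j}. - (h * p)) \<le> (\<Sum>k\<in>UNIV - {j}. A t $ i $ k * sig (x t $ i - x t $ k) \<alpha>)"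
    unfolding p_def by (intro sum_mono consensus_input_term_ge alpha_pos A_nonneg A_le assms)
  moreover have "(\<Sum>k\<in>(UNIV :: 'n set). - (h * p)) = - (h * p) + (\<Sum>k\<in>UNIV - {j}. - (h * p))"
    by (rule sum.remove) auto
  moreover have "(\<Sum>k\<in>UNIV. A t $ i $ k * sig (x t $ i - x t $ k) \<alpha>) = A t $ i $ j * sig (x t $ i - x t $ j) \<alpha>
      + (\<Sum>k\<in>UNIV - {j}. A t $ i $ k * sig (x t $ i - x t $ k) \<alpha>)"
    by (rule sum.remove) auto
  ultimately have "lo * (l / 2) powr \<alpha> - of_nat CARD('n) * (h * p)
      \<le> (\<Sum>k\<in>UNIV. A t $ i $ k * sig (x t $ i - x t $ k) \<alpha>)"
    using p by simp
  from mult_left_mono[OF this, of \<epsilon>] eps_pos show ?thesis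
    by (simp add: consensus_input_nth gain_def mult.assoc right_diff_distrib p_def)
qed

subsection \<open>Contraction of the spread\<close>

text \<open>Loops are excepted because the adjacency matrices have zero diagonal even if the graph
  contains loops.\<close>

definition edges_active :: "real \<Rightarrow> ('n \<times> 'n) set \<Rightarrow> real set \<Rightarrow> bool"
  where "edges_active lo G S \<longleftrightarrow> (\<forall>t\<in>S. \<forall>i j. (j, i) \<in> G \<longrightarrow> j \<noteq> i \<longrightarrow> lo \<le> A t $ i $ j)"

text \<open>Distances scale with \<open>V\<close> and speeds with V^\<alpha>, hence waiting times
  with V^(1-\<alpha>). \<open>U\<close> may exceed \<open>upper (x s)\<close>, so that successive
  edges can start at later times with the same reference level.\<close>

definition edge_drop :: "real \<Rightarrow> real \<Rightarrow> real \<Rightarrow> real \<Rightarrow> bool"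
  where "edge_drop lo \<delta> \<theta> \<theta>' \<longleftrightarrow> (\<forall>s e V U i j t. 0 \<le> s \<longrightarrow> 0 < V \<longrightarrow> upper (x s) \<le> U \<longrightarrow>
    (\<forall>u\<in>{s..e}. lo \<le> A u $ i $ j \<and> x u $ j \<le> U - \<theta> * V) \<longrightarrow>
    t \<in> {s + \<delta> * V powr (1 - \<alpha>)..e} \<longrightarrow> x t $ i \<le> U - \<theta>' * V)"

text \<open>The waiting time depends on \<open>d\<close> and not on the path length
  \<open>m\<close>, so that all agents within \<open>d\<close> edges of \<open>r\<close> are covered
  at the same time.\<close>

definition path_drop :: "real \<Rightarrow> real \<Rightarrow> nat \<Rightarrow> real \<Rightarrow> real \<Rightarrow> bool"
  where "path_drop lo \<delta> d \<theta> \<theta>' \<longleftrightarrow> (\<forall>s e V U G r i m t. 0 \<le> s \<longrightarrow> 0 < V \<longrightarrow> upper (x s) \<le> U \<longrightarrow>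
    edges_active lo G {s..e} \<longrightarrow> (\<forall>u\<in>{s..e}. x u $ r \<le> U - \<theta> * V) \<longrightarrow>
    m \<le> d \<longrightarrow> (r, i) \<in> G ^^ m \<longrightarrow>
    t \<in> {s + real d * \<delta> * V powr (1 - \<alpha>)..e} \<longrightarrow> x t $ i \<le> U - \<theta>' * V)"

text \<open>The root is assumed to lie in the lower half of the range; for a root in the upper half
  the negated solution is used.\<close>

definition upper_drop :: "real \<Rightarrow> real \<Rightarrow> real \<Rightarrow> bool"
  where "upper_drop lo H \<theta> \<longleftrightarrow> (\<forall>s G r. 0 \<le> s \<longrightarrow> 0 < spread (x s) \<longrightarrow>
    (\<forall>j. j \<noteq> r \<longrightarrow> (r, j) \<in> G\<^sup>+) \<longrightarrow> edges_active lo G {s..s + H * spread (x s) powr (1 - \<alpha>)} \<longrightarrow>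
    x s $ r \<le> upper (x s) - spread (x s) / 2 \<longrightarrow>
    upper (x (s + H * spread (x s) powr (1 - \<alpha>))) \<le> upper (x s) - \<theta> * spread (x s))"

lemma edge_propagation:
  assumes lo: "0 < lo" and \<theta>: "0 < \<theta>" and \<delta>: "0 < \<delta>"
  obtains \<theta>' where "0 < \<theta>'" and "\<theta>' \<le> \<theta>" and "edge_drop lo \<delta> \<theta> \<theta>'"
proof -
  \<comment> \<open>The edge pulls \<open>i\<close> down at speed at least 2 \<kappa> V^\<alpha>;
    one half is reserved for outweighing the upward pulls, the other half is the net
    descent.\<close>
  define \<kappa> where "\<kappa> = \<epsilon> * lo * (\<theta> / 2) powr \<alpha> / 2"
  have \<kappa>: "0 < \<kappa>" using lo \<theta> eps_pos by (simp add: \<kappa>_def)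
  \<comment> \<open>Gaps below \<open>\<eta> V\<close> are pulled up at rate at least \<open>\<kappa> V\<^sup>\<alpha>\<close>.\<close>
  define \<eta> where "\<eta> = (\<kappa> / (gain + 1)) powr (1 / \<alpha>)"
  have \<eta>: "0 < \<eta>" using \<kappa> gain_nonneg by (simp add: \<eta>_def)
  have "\<eta> powr \<alpha> = \<kappa> / (gain + 1)"
    using \<kappa> gain_nonneg alpha_pos by (simp add: \<eta>_def powr_powr)
  then have "gain * \<eta> powr \<alpha> + \<eta> powr \<alpha> = \<kappa>"
    using gain_nonneg by (simp add: field_simps)
  then have g\<eta>: "gain * \<eta> powr \<alpha> \<le> \<kappa>"
    using powr_ge_zero[of \<eta> \<alpha>] by linarith
  \<comment> \<open>The first bound keeps \<open>i\<close> far enough above \<open>j\<close> while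
    its gap is below \<open>\<theta>' * V\<close>, the second limits the upward pulls, and the third
    makes the waiting time long enough to descend by \<open>\<theta>' * V\<close>.\<close>
  define \<theta>' where "\<theta>' = min (\<theta> / 2) (min \<eta> (\<delta> * \<kappa>))"
  have \<theta>': "0 < \<theta>'" "\<theta>' \<le> \<theta> / 2" "\<theta>' \<le> \<eta>" "\<theta>' \<le> \<delta> * \<kappa>"
    using \<theta> \<eta> \<delta> \<kappa> by (auto simp: \<theta>'_def)
  have concl: "x t $ i \<le> U - \<theta>' * V"
    if s: "0 \<le> s" and V: "0 < V" and U: "upper (x s) \<le> U"
      and edge: "\<forall>u\<in>{s..e}. lo \<le> A u $ i $ j \<and> x u $ j \<le> U - \<theta> * V"
      and t: "t \<in> {s + \<delta> * V powr (1 - \<alpha>)..e}" for s e V U i j t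
  proof -
    have st: "s \<le> t" using t \<delta> by (auto intro: order_trans[rotated])
    have le_U: "x u $ m \<le> U" if "s \<le> u" for u m
      using component_le_upper_earlier[OF s that] U by (rule order_trans)
    show ?thesis
    proof (rule absolutely_continuous_drift_below_level[OF st absolutely_continuous_component[OF s]])
      show "x s $ i \<le> U" using le_U by simp
      show "0 \<le> \<kappa> * V powr \<alpha>" using \<kappa> by simp
      have "V powr \<alpha> * V powr (1 - \<alpha>) = V"
        using V by (simp flip: powr_add)
      then have "\<theta>' * V \<le> \<kappa> * V powr \<alpha> * (\<delta> * V powr (1 - \<alpha>))"
        using \<theta>'(4) V by (simp add: algebra_simps)
      also have "\<dots> \<le> \<kappa> * V powr \<alpha> * (t - s)"
        using t \<kappa> by (intro mult_left_mono) auto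
      finally show "\<theta>' * V \<le> \<kappa> * V powr \<alpha> * (t - s)" .
      show "AE u in lebesgue. u \<in> {s..t} \<longrightarrow> U - \<theta>' * V < x u $ i \<longrightarrow>
          straddle_rate_le {s..t} (\<lambda>u. x u $ i) (- (\<kappa> * V powr \<alpha>)) u"
      proof (rule component_straddle_rate_le[OF s])
        fix u assume u: "u \<in> {s..t}" and xi: "U - \<theta>' * V < x u $ i"
        have "\<theta>' * V \<le> \<theta> / 2 * V" using \<theta>'(2) V by (intro mult_right_mono) auto
        then have "U - \<theta> * V / 2 \<le> x u $ i" using xi by simp
        moreover have "lo \<le> A u $ i $ j" "x u $ j \<le> U - \<theta> * V"
          using bspec[OF edge, of u] u t by auto
        ultimately have "consensus_input \<epsilon> \<alpha> (A u) (x u) $ i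
            \<le> gain * (U - x u $ i) powr \<alpha> - \<epsilon> * lo * (\<theta> * V / 2) powr \<alpha>"
          using u t le_U s lo \<theta> V by (intro input_le_edge[of _ _ _ _ j]) auto
        moreover have "\<epsilon> * lo * (\<theta> * V / 2) powr \<alpha> = 2 * (\<kappa> * V powr \<alpha>)"
          using \<theta> V powr_mult[of "\<theta> / 2" V \<alpha>] by (simp add: \<kappa>_def)
        moreover have "gain * (U - x u $ i) powr \<alpha> \<le> \<kappa> * V powr \<alpha>"
        proof -
          have "U - x u $ i \<le> \<eta> * V"
            using xi mult_right_mono[OF \<theta>'(3), of V] V by linarith
          then have "(U - x u $ i) powr \<alpha> \<le> (\<eta> * V) powr \<alpha>"
            using le_U u alpha_pos by (intro powr_mono2) auto
          also have "\<dots> = \<eta> powr \<alpha> * V powr \<alpha>" using \<eta> V by (simp add: powr_mult)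
          finally have "gain * (U - x u $ i) powr \<alpha> \<le> (gain * \<eta> powr \<alpha>) * V powr \<alpha>"
            using gain_nonneg by (simp add: mult_left_mono mult.assoc)
          also have "\<dots> \<le> \<kappa> * V powr \<alpha>"
            using g\<eta> by (intro mult_right_mono) auto
          finally show ?thesis .
        qed
        ultimately show "consensus_input \<epsilon> \<alpha> (A u) (x u) $ i \<le> - (\<kappa> * V powr \<alpha>)"
          by linarith
      qed
    qed
  qed
  have "\<theta>' \<le> \<theta>" using \<theta>'(2) \<theta> by simp
  moreover have "edge_drop lo \<delta> \<theta> \<theta>'"
    unfolding edge_drop_def by (intro allI impI) (rule concl)
  ultimately show thesis using \<theta>'(1) that by blast
qed

text \<open>By induction on the number of edges: each further edge costs one more waiting time and a
  smaller fraction. The fraction is fixed before the graph, the root and the path.\<close>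

lemma path_propagation:
  assumes lo: "0 < lo" and \<theta>\<^sub>0: "0 < \<theta>\<^sub>0" and \<delta>: "0 < \<delta>"
  shows "\<exists>\<theta>>0. \<theta> \<le> \<theta>\<^sub>0 \<and> path_drop lo \<delta> d \<theta>\<^sub>0 \<theta>"
proof (induction d)
  case 0
  have "path_drop lo \<delta> 0 \<theta>\<^sub>0 \<theta>\<^sub>0"
    by (simp add: path_drop_def)
  then show ?case using \<theta>\<^sub>0 by blast
next
  case (Suc d)
  then obtain \<theta> where \<theta>: "0 < \<theta>" "\<theta> \<le> \<theta>\<^sub>0" and IH: "path_drop lo \<delta> d \<theta>\<^sub>0 \<theta>"
    by blast
  obtain \<theta>' where \<theta>': "0 < \<theta>'" "\<theta>' \<le> \<theta>" and step: "edge_drop lo \<delta> \<theta> \<theta>'"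
    using edge_propagation[OF lo \<theta>(1) \<delta>] by blast
  have "path_drop lo \<delta> (Suc d) \<theta>\<^sub>0 \<theta>'"
    unfolding path_drop_def
  proof (intro allI impI)
    fix s e V U G r i m t
    assume s: "0 \<le> s" and V: "0 < V" and U: "upper (x s) \<le> U" and G: "edges_active lo G {s..e}"
      and r: "\<forall>u\<in>{s..e}. x u $ r \<le> U - \<theta>\<^sub>0 * V" and m: "m \<le> Suc d" and i: "(r, i) \<in> G ^^ m"
      and t: "t \<in> {s + real (Suc d) * \<delta> * V powr (1 - \<alpha>)..e}"
    define w where "w = \<delta> * V powr (1 - \<alpha>)"
    have w: "0 \<le> w" using \<delta> by (simp add: w_def)
    have dw: "0 \<le> real d * w" using w by simp
    have ts: "s + real d * w + w \<le> t" "t \<le> e" using t by (auto simp: w_def algebra_simps)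
    have \<theta>V: "\<theta>' * V \<le> \<theta> * V" using \<theta>' V by simp
    have IH': "x u $ k \<le> U - \<theta> * V" if "n \<le> d" "(r, k) \<in> G ^^ n" "u \<in> {s + real d * w..e}" for n k u
      using r that(3) by (intro IH[unfolded path_drop_def, rule_format, OF s V U G _ that(1,2)])
        (simp_all add: w_def mult.assoc)
    show "x t $ i \<le> U - \<theta>' * V"
    proof (cases "m \<le> d")
      case True
      then have "x t $ i \<le> U - \<theta> * V" using i ts w by (intro IH'[of m]) auto
      then show ?thesis using \<theta>V by simp
    next
      case False
      then have "m = Suc d" using m by simp
      with i obtain j where rj: "(r, j) \<in> G ^^ d" and ji: "(j, i) \<in> G" by auto
      note xj = IH'[OF order_refl rj]
      show ?thesis
      \<comment> \<open>A loop carries no weight, but then the induction hypothesis already speaks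
        about \<open>i\<close>.\<close>
      proof (cases "j = i")
        case True
        then have "x t $ i \<le> U - \<theta> * V" using xj[of t] ts w by simp
        then show ?thesis using \<theta>V by simp
      next
        case False
        have "lo \<le> A u $ i $ j" if "u \<in> {s + real d * w..e}" for u
        proof -
          have "u \<in> {s..e}" using that dw by simp
          then show ?thesis using G ji False unfolding edges_active_def by blast
        qed
        then have edge: "\<forall>u\<in>{s + real d * w..e}. lo \<le> A u $ i $ j \<and> x u $ j \<le> U - \<theta> * V"
          using xj by blast
        \<comment> \<open>The clock is restarted once \<open>j\<close> has its gap; the level
          \<open>U\<close> still bounds all states.\<close>
        have "upper (x (s + real d * w)) \<le> U"
          using upper_antimono[of s "s + real d * w"] s dw U by simp
        moreover have "0 \<le> s + real d * w" "t \<in> {s + real d * w + \<delta> * V powr (1 - \<alpha>)..e}"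
          using s dw ts by (simp_all add: w_def)
        ultimately show ?thesis
          using V edge by (intro step[unfolded edge_drop_def, rule_format, of "s + real d * w" V U e i j t]) auto
      qed
    qed
  qed
  moreover have "\<theta>' \<le> \<theta>\<^sub>0" using \<theta> \<theta>' by simp
  ultimately show ?case using \<theta>'(1) by blast
qed

lemma upper_decrease:
  assumes lo: "0 < lo" and H: "0 < H" and gH: "gain * H \<le> 1 / 4"
  obtains \<theta> where "0 < \<theta>" and "\<theta> \<le> 1 / 4" and "upper_drop lo H \<theta>"
proof -
  \<comment> \<open>The number of all possible edges bounds the path lengths needed in every graph,
    so \<theta> is uniform over graphs. Each of the \<open>d\<close> edges receives the share
    \<open>H / real d\<close> of the time.\<close>
  define d where "d = card (UNIV :: ('n \<times> 'n) set)"
  have d: "0 < d" unfolding d_def by (rule finite_UNIV_card_ge_0) simp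
  obtain \<theta> where \<theta>: "0 < \<theta>" "\<theta> \<le> 1 / 4" and path: "path_drop lo (H / real d) d (1 / 4) \<theta>"
    using path_propagation[OF lo, of "1 / 4" "H / real d" d] H d by auto
  have "upper (x (s + H * V powr (1 - \<alpha>))) \<le> upper (x s) - \<theta> * V"
    if s: "0 \<le> s" and V: "0 < V" "V = spread (x s)" and tree: "\<forall>j. j \<noteq> r \<longrightarrow> (r, j) \<in> G\<^sup>+"
      and G: "edges_active lo G {s..s + H * V powr (1 - \<alpha>)}"
      and r: "x s $ r \<le> upper (x s) - V / 2" for s V G r
  proof -
    define e where "e = s + H * V powr (1 - \<alpha>)"
    have se: "s \<le> e" using H by (simp add: e_def)
    \<comment> \<open>All gaps are at most \<open>V\<close>, so the root rises at speed at most gain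
      V^\<alpha>, hence by at most gain H V \<le> V/4 in the available time; it started at least V/2
      below the maximum.\<close>
    have root: "x t $ r \<le> upper (x s) - 1 / 4 * V" if t: "t \<in> {s..e}" for t
    proof -
      have "AE u in lebesgue. u \<in> {s..t} \<longrightarrow> True \<longrightarrow>
          straddle_rate_le {s..t} (\<lambda>u. x u $ r) (gain * V powr \<alpha>) u"
      proof (rule component_straddle_rate_le[OF s])
        fix u assume u: "u \<in> {s..t}"
        then have "consensus_input \<epsilon> \<alpha> (A u) (x u) $ r \<le> gain * (upper (x s) - x u $ r) powr \<alpha>"
          using s component_le_upper_earlier by (intro input_le) auto
        also have "\<dots> \<le> gain * V powr \<alpha>"
          using s u V alpha_pos component_le_upper_earlier[of s u r] upper_minus_component_le[of s u r]
          by (intro mult_left_mono powr_mono2 gain_nonneg) auto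
        finally show "consensus_input \<epsilon> \<alpha> (A u) (x u) $ r \<le> gain * V powr \<alpha>" .
      qed
      then have "x t $ r - x s $ r \<le> gain * V powr \<alpha> * (t - s)"
        using t s by (intro absolutely_continuous_increment_le absolutely_continuous_component) auto
      also have "\<dots> \<le> gain * V powr \<alpha> * (H * V powr (1 - \<alpha>))"
        using t gain_nonneg by (intro mult_left_mono) (auto simp: e_def)
      also have "\<dots> = gain * H * (V powr \<alpha> * V powr (1 - \<alpha>))" by (simp add: algebra_simps)
      also have "V powr \<alpha> * V powr (1 - \<alpha>) = V" using V(1) by (simp flip: powr_add)
      also have "gain * H * V \<le> 1 / 4 * V" using gH V(1) by (intro mult_right_mono) auto
      finally show ?thesis using r by simp
    qed
    have "x e $ i \<le> upper (x s) - \<theta> * V" for i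
    proof -
      have "(r, i) \<in> G\<^sup>*" using tree by (cases "i = r") (auto intro: trancl_into_rtrancl)
      then obtain m where m: "(r, i) \<in> G ^^ m" "m \<le> card G"
        using rtrancl_finite_eq_relpow[of G] by auto
      moreover have "card G \<le> d" unfolding d_def by (rule card_mono) auto
      ultimately show ?thesis
        using path[unfolded path_drop_def, rule_format, of s V "upper (x s)" G e r m i e] root G s V se d
        by (simp add: e_def)
    qed
    then show ?thesis unfolding e_def by (rule upper_le)
  qed
  then have "upper_drop lo H \<theta>"
    unfolding upper_drop_def by blast
  then show thesis using \<theta> that by blast
qed

text \<open>A root in the lower half of the range drags the maximum down; one in the upper half does
  the same for the negated solution. The opposite extreme never moves outwards, so the spread
  shrinks in both cases.\<close>

lemma spread_contraction:
  assumes lo: "0 < lo" and H: "0 < H" and gH: "gain * H \<le> 1 / 4"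
  shows "\<exists>q>0. q < 1 \<and> (\<forall>s G. 0 \<le> s \<longrightarrow> has_directed_spanning_tree G \<longrightarrow>
    edges_active lo G {s..s + H * spread (x s) powr (1 - \<alpha>)} \<longrightarrow>
    spread (x (s + H * spread (x s) powr (1 - \<alpha>))) \<le> q * spread (x s))"
proof -
  interpret neg: consensus_flow \<epsilon> \<alpha> h A "\<lambda>t. - x t" by (rule reflected)
  have spread_neg: "spread (- z) = spread z" for z :: "real ^ 'n" by (simp add: spread_def)
  obtain \<theta> where \<theta>: "0 < \<theta>" "\<theta> \<le> 1 / 4" and up: "upper_drop lo H \<theta>"
    using upper_decrease[OF assms] by blast
  obtain \<theta>' where \<theta>': "0 < \<theta>'" "\<theta>' \<le> 1 / 4" and down: "neg.upper_drop lo H \<theta>'"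
    using neg.upper_decrease[OF lo H gH] by blast
  define q where "q = 1 - min \<theta> \<theta>'"
  have q: "0 < q" "q < 1" using \<theta> \<theta>' by (auto simp: q_def min_def)
  have "spread (x (s + H * V powr (1 - \<alpha>))) \<le> q * V"
    if s: "0 \<le> s" and tree: "has_directed_spanning_tree G" and V: "V = spread (x s)"
      and G: "edges_active lo G {s..s + H * V powr (1 - \<alpha>)}" for s G V
  \<comment> \<open>As \<open>0 powr (1 - \<alpha>) = 0\<close>, the time interval degenerates to
    \<open>s\<close>, where the spread is already 0.\<close>
  proof (cases "V = 0")
    case True
    then show ?thesis using V by simp
  next
    case False
    then have V0: "0 < V" using V spread_nonneg[of "x s"] by simp
    have se: "s \<le> s + H * V powr (1 - \<alpha>)" using H by simp
    obtain r where r: "\<forall>j. j \<noteq> r \<longrightarrow> (r, j) \<in> G\<^sup>+"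
      using tree unfolding has_directed_spanning_tree_def by blast
    have qV: "V - \<theta> * V \<le> q * V" "V - \<theta>' * V \<le> q * V"
      using V0 by (auto simp: q_def min_def algebra_simps)
    show ?thesis
    proof (cases "x s $ r \<le> upper (x s) - V / 2")
      case True
      then show ?thesis
        using up[unfolded upper_drop_def, rule_format, of s r G] s r G V V0 lower_mono[OF s se] qV by (simp add: spread_neg) (simp add: spread_def)
    next
      case False
      then have "- x s $ r \<le> upper (- x s) - V / 2"
        using V unfolding spread_def by (simp add: field_simps)
      then show ?thesis
        using down[unfolded neg.upper_drop_def, rule_format, of s r G] s r G V V0 upper_antimono[OF s se] qV by (simp add: spread_neg) (simp add: spread_def)
    qed
  qed
  then show ?thesis using q by blast
qed

section \<open>Decay across the switching times and extinction within one dwell interval\<close>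

lemma finite_time_consensus:
  assumes \<alpha>1: "\<alpha> < 1" and lo: "0 < lo"
    and \<tau>0: "\<tau> 0 = 0" and tL: "0 < t\<^sub>L" and dwell: "\<And>k. t\<^sub>L \<le> \<tau> (Suc k) - \<tau> k"
    and tree: "\<And>k. has_directed_spanning_tree (W k)"
    and active: "\<And>k. edges_active lo (W k) {\<tau> k..<\<tau> (Suc k)}"
  obtains T where "0 \<le> T" and "\<And>t. T \<le> t \<Longrightarrow> spread (x t) = 0"
proof -
  define \<beta> where "\<beta> = 1 - \<alpha>"
  have \<beta>: "0 < \<beta>" using \<alpha>1 by (simp add: \<beta>_def)
  have \<tau>_nonneg: "0 \<le> \<tau> k" for k
  proof (induction k)
    case (Suc k)
    then show ?case using dwell[of k] tL by simp
  qed (simp add: \<tau>0)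
  \<comment> \<open>Adding 1 keeps the bound positive even if the agents start in consensus.\<close>
  define V\<^sub>0 where "V\<^sub>0 = spread (x 0) + 1"
  have V\<^sub>0: "0 < V\<^sub>0" "spread (x 0) \<le> V\<^sub>0"
    using spread_nonneg[of "x 0"] by (auto simp: V\<^sub>0_def)
  \<comment> \<open>The first bound ensures \<open>gain * H \<le> 1 / 4\<close>; the second makes a
    contraction starting from spread at most \<open>V\<^sub>0\<close> last at most half a minimal
    dwell time.\<close>
  define H where "H = min (1 / (4 * (gain + 1))) (t\<^sub>L / (2 * V\<^sub>0 powr \<beta>))"
  have H: "0 < H" using gain_nonneg tL V\<^sub>0 by (simp add: H_def)
  have "gain * H \<le> gain * (1 / (4 * (gain + 1)))"
    using gain_nonneg by (intro mult_left_mono) (auto simp: H_def)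
  also have "\<dots> \<le> 1 / 4" using gain_nonneg by (simp add: divide_simps)
  finally have gH: "gain * H \<le> 1 / 4" .
  have "H * V\<^sub>0 powr \<beta> \<le> t\<^sub>L / (2 * V\<^sub>0 powr \<beta>) * V\<^sub>0 powr \<beta>"
    by (intro mult_right_mono) (auto simp: H_def)
  also have "\<dots> = t\<^sub>L / 2" using V\<^sub>0 by simp
  finally have HV\<^sub>0: "H * V\<^sub>0 powr \<beta> < t\<^sub>L" using tL by simp
  obtain q where q: "0 < q" "q < 1" and contraction: "\<And>s G. 0 \<le> s \<Longrightarrow> has_directed_spanning_tree G \<Longrightarrow>
      edges_active lo G {s..s + H * spread (x s) powr (1 - \<alpha>)} \<Longrightarrow>
      spread (x (s + H * spread (x s) powr (1 - \<alpha>))) \<le> q * spread (x s)"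
    using spread_contraction[OF lo H gH] by blast
  \<comment> \<open>The contraction is restated for an upper bound \<open>v\<close> of the spread:
    it is complete no later than the time computed from \<open>v\<close>, and the spread does not
    grow afterwards. The end lies strictly before the switching time because the edges are active on
    a half-open interval.\<close>
  have step: "spread (x (s + H * v powr \<beta>)) \<le> q * v"
    if s: "\<tau> k \<le> s" "s + H * v powr \<beta> < \<tau> (Suc k)" and v: "spread (x s) \<le> v" for k s v
  proof -
    have s0: "0 \<le> s" using \<tau>_nonneg[of k] s by simp
    define s' where "s' = s + H * spread (x s) powr \<beta>"
    have s': "s \<le> s'" "s' \<le> s + H * v powr \<beta>"
      using H v \<beta> spread_nonneg[of "x s"] by (auto simp: s'_def intro!: powr_mono2)
    have "edges_active lo (W k) {s..s'}"
      using active[of k] s s' unfolding edges_active_def by auto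
    then have "spread (x s') \<le> q * spread (x s)"
      using contraction[OF s0 tree[of k]] by (simp add: s'_def \<beta>_def)
    moreover have "spread (x (s + H * v powr \<beta>)) \<le> spread (x s')"
      using s' s0 by (intro spread_antimono) auto
    moreover have "q * spread (x s) \<le> q * v" using q v by simp
    ultimately show ?thesis by linarith
  qed
  have decay: "spread (x (\<tau> k)) \<le> q ^ k * V\<^sub>0" for k
  proof (induction k)
    case 0
    then show ?case using V\<^sub>0 \<tau>0 by simp
  next
    case (Suc k)
    have "(q ^ k * V\<^sub>0) powr \<beta> \<le> V\<^sub>0 powr \<beta>"
      using q V\<^sub>0 \<beta> by (intro powr_mono2) (auto simp: mult_left_le_one_le power_le_one)
    then have "H * (q ^ k * V\<^sub>0) powr \<beta> \<le> H * V\<^sub>0 powr \<beta>"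
      using H by simp
    then have lt: "\<tau> k + H * (q ^ k * V\<^sub>0) powr \<beta> < \<tau> (Suc k)"
      using HV\<^sub>0 dwell[of k] by simp
    have "spread (x (\<tau> (Suc k))) \<le> spread (x (\<tau> k + H * (q ^ k * V\<^sub>0) powr \<beta>))"
      using \<tau>_nonneg[of k] H lt by (intro spread_antimono) auto
    also have "\<dots> \<le> q * (q ^ k * V\<^sub>0)"
      using lt Suc by (intro step[of k]) auto
    finally show ?case by simp
  qed
  \<comment> \<open>When the spread bound shrinks by \<open>q\<close>, the duration of the next
    contraction shrinks by \<open>p\<close>.\<close>
  define p where "p = q powr \<beta>"
  have p: "0 < p" "p < 1" using q \<beta> powr_less_mono2[of \<beta> q 1] by (auto simp: p_def)
  have pow: "(q ^ j * v) powr \<beta> = p ^ j * v powr \<beta>" if "0 < v" for j v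
    using q that by (simp add: powr_mult p_def powr_power powr_powr mult.commute flip: powr_realpow)
  \<comment> \<open>\<open>K\<close> is chosen so late that all remaining contractions together take
    \<open>w / (1 - p)\<close>, less than the dwell time.\<close>
  obtain K where K: "p ^ K < t\<^sub>L * (1 - p) / (H * V\<^sub>0 powr \<beta>)"
    using real_arch_pow_inv[of "t\<^sub>L * (1 - p) / (H * V\<^sub>0 powr \<beta>)" p] p tL H V\<^sub>0 by auto
  define v where "v = q ^ K * V\<^sub>0"
  have v: "0 < v" using q V\<^sub>0 by (simp add: v_def)
  define w where "w = H * v powr \<beta>"
  have w: "0 < w" using H v by (simp add: w_def)
  have "w = p ^ K * (H * V\<^sub>0 powr \<beta>)" using pow[OF V\<^sub>0(1), of K] by (simp add: w_def v_def)
  then have w_less: "w / (1 - p) < t\<^sub>L" using K p H V\<^sub>0 by (simp add: field_simps)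
  \<comment> \<open>The time at which \<open>j\<close> successive contractions in the
    \<open>K\<close>-th dwell interval are complete.\<close>
  define s where "s j = \<tau> K + w * (\<Sum>i<j. p ^ i)" for j
  have s_less: "s j < \<tau> (Suc K)" for j
  proof -
    have "(\<Sum>i<j. p ^ i) = (1 - p ^ j) / (1 - p)"
      using p by (simp add: sum_gp_strict)
    also have "\<dots> \<le> 1 / (1 - p)" using p by (intro divide_right_mono) auto
    finally have "w * (\<Sum>i<j. p ^ i) \<le> w * (1 / (1 - p))"
      using w by (intro mult_left_mono) auto
    then show ?thesis using w_less dwell[of K] by (simp add: s_def)
  qed
  have s_ge: "\<tau> K \<le> s j" for j
    using w p by (simp add: s_def sum_nonneg)
  have spread_s: "spread (x (s j)) \<le> q ^ j * v" for j
  proof (induction j)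
    case 0
    then show ?case using decay[of K] by (simp add: s_def v_def)
  next
    case (Suc j)
    have "s j + H * (q ^ j * v) powr \<beta> = s (Suc j)"
      using pow[OF v, of j] by (simp add: s_def w_def algebra_simps)
    then show ?case
      using step[OF s_ge[of j] _ Suc] s_less[of "Suc j"] by (simp add: mult.assoc)
  qed
  \<comment> \<open>All times \<open>s j\<close> precede the next switching time, so every one of
    these bounds holds there.\<close>
  have "spread (x (\<tau> (Suc K))) \<le> q ^ j * v" for j
    using spread_antimono[of "s j" "\<tau> (Suc K)"] s_ge[of j] \<tau>_nonneg[of K] s_less[of j] spread_s[of j]
    by simp
  moreover have "(\<lambda>j. q ^ j * v) \<longlonglongrightarrow> 0"
    using q by (intro tendsto_mult_left_zero LIMSEQ_power_zero) simp
  ultimately have "spread (x (\<tau> (Suc K))) \<le> 0"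
    by (intro LIMSEQ_le_const) auto
  then have "spread (x t) = 0" if "\<tau> (Suc K) \<le> t" for t
    using spread_antimono[OF \<tau>_nonneg that] spread_nonneg[of "x t"] by linarith
  then show thesis using that \<tau>_nonneg by blast
qed

end

section \<open>From the switching graphs to uniform weight bounds\<close>

theorem mainTheorem4:
  fixes \<epsilon> \<alpha> t\<^sub>L a_lo a_hi :: real
    and \<tau> :: "nat \<Rightarrow> real"
    and W :: "nat \<Rightarrow> ('n::finite \<times> 'n) set"
    and A\<^sub>k :: "nat \<Rightarrow> real ^ 'n ^ 'n"
    and A :: "real \<Rightarrow> real ^ 'n ^ 'n"
    and x :: "real \<Rightarrow> real ^ 'n"
  assumes "\<epsilon> > 0" and "0 < \<alpha>" and "\<alpha> < 1"
    and "\<tau> 0 = 0" and "t\<^sub>L > 0" and "\<And>k. \<tau> (Suc k) - \<tau> k \<ge> t\<^sub>L"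
    and "\<And>k t. t \<in> {\<tau> k..<\<tau> (Suc k)} \<Longrightarrow> A t = A\<^sub>k k"
    and "\<And>k. is_adjacency_matrix (W k) (A\<^sub>k k)"
    and "a_lo > 0" and "a_hi > 0"
    and "\<And>k i j. A\<^sub>k k $ i $ j \<noteq> 0 \<Longrightarrow> A\<^sub>k k $ i $ j \<in> {a_lo..a_hi}"
    and "\<And>k. has_directed_spanning_tree (W k)"
    and "caratheodory_solution (\<lambda>t y. consensus_input \<epsilon> \<alpha> (A t) y) x"
  shows "\<forall>i j. converges_to_zero_in_finite_time (\<lambda>t. x t $ i - x t $ j)"
proof -
  note \<tau>0 = assms(4) and tL = assms(5) and dwell = assms(6) and A_eq = assms(7)
    and adj = assms(8) and bounds = assms(11)
  \<comment> \<open>The switching times are unbounded, so the dwell intervals cover all nonnegative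
    times and the bounds on the matrices \<open>A\<^sub>k\<close> carry over to
    \<open>A t\<close>.\<close>
  have \<tau>_ge: "real k * t\<^sub>L \<le> \<tau> k" for k
  proof (induction k)
    case (Suc k)
    then show ?case using dwell[of k] by (simp add: algebra_simps)
  qed (simp add: \<tau>0)
  have A_bounds: "0 \<le> A t $ i $ j \<and> A t $ i $ j \<le> a_hi" if "0 \<le> t" for t i j
  proof -
    obtain n :: nat where "t / t\<^sub>L < real n" using reals_Archimedean2 by blast
    then have "t < \<tau> n" using \<tau>_ge[of n] tL by (simp add: field_simps)
    moreover have "\<not> t < \<tau> 0" using that \<tau>0 by simp
    ultimately obtain k where "\<tau> k \<le> t" "t < \<tau> (Suc k)"
      using ex_least_nat_less[of "\<lambda>k. t < \<tau> k" n] by (auto simp: not_less)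
    then have "A t = A\<^sub>k k" by (intro A_eq) simp
    then show ?thesis
      using bounds[of k i j] assms(9,10) by (cases "A\<^sub>k k $ i $ j = 0") auto
  qed
  interpret consensus_flow \<epsilon> \<alpha> a_hi A x
    by (rule consensus_flow.intro) (use assms(1,2,13) A_bounds in blast)+
  have "a_lo \<le> A t $ i $ j" if t: "t \<in> {\<tau> k..<\<tau> (Suc k)}" and ji: "(j, i) \<in> W k" "j \<noteq> i" for k t i j
  proof -
    have "A\<^sub>k k $ i $ j > 0"
      using adj[of k] ji unfolding is_adjacency_matrix_def by metis
    then show ?thesis
      using A_eq[OF t] bounds[of k i j] by simp
  qed
  then have active: "edges_active a_lo (W k) {\<tau> k..<\<tau> (Suc k)}" for k
    unfolding edges_active_def by blast
  obtain T where T: "0 \<le> T" "\<And>t. T \<le> t \<Longrightarrow> spread (x t) = 0"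
    using finite_time_consensus[OF assms(3,9) \<tau>0 tL dwell assms(12) active] by blast
  have "x t $ i - x t $ j = 0" if "T \<le> t" for i j t
    using T(2)[OF that] component_diff_le_spread[of "x t" i j] component_diff_le_spread[of "x t" j i]
    by simp
  then show ?thesis
    using T(1) unfolding converges_to_zero_in_finite_time_def by blast
qed

end
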